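(* Let $n\in\mathbb N$. (i) If $n=2^m$ with $m\ge 1$: for $m=1$, $C(n,x)$ has a vanishing zero. For $m\ge 2$, the number of positive zeros of $C(n,x)$ and the number of negative zeros both equal $n/4$, and the zeros are $\pm 2\cos\left(\frac{\pi}{n}(2l+1)\right)$, $l=0,1,\dots,\frac n4-1$. (ii) If $n=1$, then $C(1,x)$ has only the negative zero $-2$. If $n\ge 3$ is not a power of $2$, let $p_1,\dots,p_{M}$ with $M=M(n)$ be the distinct odd primes dividing $n$. Then the number $\delta_+(n)$ of positive zeros of $C(n,x)$ is $$\delta_+(n)=K(n)+\sum_{r=1}^{M(n)}(-1)^r\sum_{1\le i_1<i_2<\dots<i_r\le M(n)}\left\lfloor\frac12\left(\frac{L(n)}{p_{i_1}\cdots p_{i_r}}-1\right)\right\rfloor ,$$ where $L(n)=2K(n)+1$ and - $K(n)=\left\lfloor\frac{n-2}{4}\right\rfloor$ if $n$ is even, - $K(n)=\frac{n-5}{4}$ if $n\equiv 1\pmod 4$ (so $L(n)=\frac{n-3}{2}$), - $K(n)=\frac{n-3}{4}$ if $n\equiv 3\pmod 4$ (so $L(n)=\frac{n-1}{2}$). (iii) If $n\ge 3$ is not a power of $2$, then, with $M(n)$, $p_1,\dots,p_{M(n)}$ and $L(n)$ as in (ii), the number $\delta_-(n)$ of negative zeros of $C(n,x)$ is $$\delta_-(n)=N(n)+\sum_{r=1}^{M(n)}(-1)^r\sum_{1\le i_1<\dots<i_r\le M(n)}\left\{\left\lfloor\frac12\left(\frac{P(n)}{p_{i_1}\cdots p_{i_r}}-1\right)\right\rfloor-\left\lfloor\frac12\left(\frac{L(n)}{p_{i_1}\cdots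 p_{i_r}}-1\right)\right\rfloor\right\},$$ where - $N(n)=\frac{n-2}{2}-\left\lfloor\frac{n-2}{4}\right\rfloor$ and $P(n)=n-1$ if $n$ is even, - $N(n)=\frac{n-1}{4}$ and $P(n)=n-2$ if $n\equiv 1\pmod 4$, - $N(n)=\frac{n-3}{4}$ and $P(n)=n-2$ if $n\equiv 3\pmod 4$.
   Context: $C(n,x)$ denotes the minimal polynomial over $\mathbb Q$ of $\rho(n)=2\cos(\pi/n)$; all its zeros are real and simple. $\lfloor\cdot\rfloor$ is the usual floor function, so the floor terms may take negative values. *)

theory Defs
  imports Complex_Main "HOL-Computational_Algebra.Computational_Algebra"
begin

text \<open>
  Minimal polynomials over the rationals. The notion \<open>Irr\<close> of HOL-Algebra lives on explicit ring
  structures and coefficient lists; here the type \<open>rat poly\<close> is used instead. The description is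
  a definite one; \<open>ex1_rat_min_poly\<close> shows that it is proper for every algebraic number.
\<close>

definition is_rat_min_poly :: "rat poly \<Rightarrow> 'a :: field_char_0 \<Rightarrow> bool" where
  "is_rat_min_poly p x \<longleftrightarrow>
     lead_coeff p = 1 \<and> poly (map_poly of_rat p) x = 0 \<and>
     (\<forall>q. q \<noteq> 0 \<and> poly (map_poly of_rat q) x = 0 \<longrightarrow> degree p \<le> degree q)"

definition rat_min_poly :: "'a :: field_char_0 \<Rightarrow> rat poly" where
  "rat_min_poly x = (THE p. is_rat_min_poly p x)"

lemma poly_of_rat_diff:
  "poly (map_poly of_rat (p - q)) x =
     poly (map_poly of_rat p) x - poly (map_poly of_rat q) (x :: 'a :: field_char_0)"
proof -
  have "map_poly of_rat (p - q) = map_poly of_rat p - (map_poly of_rat q :: 'a poly)"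
    by (rule poly_eqI) (simp add: coeff_map_poly of_rat_diff)
  thus ?thesis by simp
qed

lemma poly_of_rat_smult:
  "poly (map_poly of_rat (smult c p)) x =
     of_rat c * poly (map_poly of_rat p) (x :: 'a :: field_char_0)"
proof -
  have "map_poly of_rat (smult c p) = smult (of_rat c) (map_poly of_rat p :: 'a poly)"
    by (rule poly_eqI) (simp add: coeff_map_poly of_rat_mult)
  thus ?thesis by simp
qed

lemma is_rat_min_poly_unique:
  fixes x :: "'a :: field_char_0"
  assumes p: "is_rat_min_poly p x" and q: "is_rat_min_poly q x"
  shows "p = q"
proof (rule ccontr)
  assume "p \<noteq> q"
  have ne: "p \<noteq> 0" "q \<noteq> 0" and lc: "lead_coeff p = 1" "lead_coeff q = 1"
    using p q by (auto simp: is_rat_min_poly_def)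
  have deg: "degree p = degree q"
    using p q ne by (auto simp: is_rat_min_poly_def intro!: antisym)
  have "poly (map_poly of_rat (p - q)) x = 0"
    using p q by (simp add: poly_of_rat_diff is_rat_min_poly_def)
  hence le: "degree p \<le> degree (p - q)"
    using p \<open>p \<noteq> q\<close> by (auto simp: is_rat_min_poly_def)
  have "degree (p - q) \<le> degree p"
    using degree_diff_le_max[of p q] deg by simp
  with le have "degree (p - q) = degree p" by simp
  moreover have "coeff (p - q) (degree p) = 0" using lc deg by simp
  ultimately have "lead_coeff (p - q) = 0" by simp
  thus False using \<open>p \<noteq> q\<close> by (metis leading_coeff_0_iff right_minus_eq)
qed

lemma ex1_rat_min_poly:
  fixes x :: "'a :: field_char_0"
  assumes "algebraic x"
  shows "\<exists>!p. is_rat_min_poly p x"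
proof -
  let ?P = "\<lambda>q :: rat poly. q \<noteq> 0 \<and> poly (map_poly of_rat q) x = 0"
  obtain r :: "'a poly" where r: "\<And>i. coeff r i \<in> \<rat>" "r \<noteq> 0" "poly r x = 0"
    using assms unfolding algebraic_altdef by blast
  obtain g :: "'a \<Rightarrow> rat" where g: "\<And>y. y \<in> \<rat> \<Longrightarrow> of_rat (g y) = y" "g 0 = 0"
  proof (rule that[of "\<lambda>y. if y = 0 then 0 else SOME z. of_rat z = y"])
    fix y :: 'a assume "y \<in> \<rat>"
    then obtain z where "of_rat z = y" by (auto elim: Rats_cases)
    thus "of_rat (if y = 0 then 0 else SOME z. of_rat z = y) = y"
      by (auto intro: someI)
  qed simp
  have map: "map_poly of_rat (map_poly g r) = r"
    by (rule poly_eqI) (simp add: coeff_map_poly g r(1))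
  have "?P (map_poly g r)" using r map by auto
  then obtain q where q: "?P q" and min: "\<And>q'. ?P q' \<Longrightarrow> degree q \<le> degree q'"
    using ex_has_least_nat[of ?P _ degree] by blast
  have "is_rat_min_poly (smult (inverse (lead_coeff q)) q) x"
    using q min by (auto simp: is_rat_min_poly_def poly_of_rat_smult)
  thus ?thesis using is_rat_min_poly_unique by blast
qed

definition rho :: "nat \<Rightarrow> real" where
  "rho n = 2 * cos (pi / real n)"

definition C_poly :: "nat \<Rightarrow> rat poly" where
  "C_poly n = rat_min_poly (rho n)"

definition C_zeros :: "nat \<Rightarrow> complex set" where
  "C_zeros n = {z. poly (map_poly of_rat (C_poly n)) z = 0}"

text \<open>All zeros being simple, counting zeros amounts to counting distinct zeros.\<close>

definition delta_pos :: "nat \<Rightarrow> nat" where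
  "delta_pos n = card {x :: real. x > 0 \<and> complex_of_real x \<in> C_zeros n}"

definition delta_neg :: "nat \<Rightarrow> nat" where
  "delta_neg n = card {x :: real. x < 0 \<and> complex_of_real x \<in> C_zeros n}"

definition odd_primes_of :: "nat \<Rightarrow> nat set" where
  "odd_primes_of n = {p. prime p \<and> odd p \<and> p dvd n}"

definition M_num :: "nat \<Rightarrow> nat" where
  "M_num n = card (odd_primes_of n)"

text \<open>
  The parameters are real-valued so that no subtraction or division is truncated; their values
  are integers in the range \<open>n \<ge> 3\<close> in which they are used.
\<close>

definition K_num :: "nat \<Rightarrow> real" where
  "K_num n =
     (if even n then of_int \<lfloor>(real n - 2) / 4\<rfloor>
      else if n mod 4 = 1 then (real n - 5) / 4
      else (real n - 3) / 4)"

definition L_num :: "nat \<Rightarrow> real" where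
  "L_num n = 2 * K_num n + 1"

lemma L_num_1_mod_4: "n mod 4 = 1 \<Longrightarrow> L_num n = (real n - 3) / 2"
proof -
  assume n: "n mod 4 = 1"
  hence "odd n" by presburger
  with n show ?thesis by (simp add: L_num_def K_num_def field_simps)
qed

lemma L_num_3_mod_4: "n mod 4 = 3 \<Longrightarrow> L_num n = (real n - 1) / 2"
proof -
  assume n: "n mod 4 = 3"
  hence "odd n" by presburger
  with n show ?thesis by (simp add: L_num_def K_num_def field_simps)
qed

definition N_num :: "nat \<Rightarrow> real" where
  "N_num n =
     (if even n then (real n - 2) / 2 - of_int \<lfloor>(real n - 2) / 4\<rfloor>
      else if n mod 4 = 1 then (real n - 1) / 4
      else (real n - 3) / 4)"

definition P_num :: "nat \<Rightarrow> real" where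
  "P_num n = (if even n then real n - 1 else real n - 2)"

text \<open>
  A choice of indices \<open>i\<^sub>1 < \<dots> < i\<^sub>r\<close> from \<open>{1..M}\<close> is the same as an \<open>r\<close>-element set of
  odd primes dividing \<open>n\<close>.
\<close>

definition prime_choices :: "nat \<Rightarrow> nat \<Rightarrow> nat set set" where
  "prime_choices n r = {S. S \<subseteq> odd_primes_of n \<and> card S = r}"

definition half_floor :: "real \<Rightarrow> nat set \<Rightarrow> int" where
  "half_floor y S = \<lfloor>1 / 2 * (y / real (\<Prod>S) - 1)\<rfloor>"

end

(*
  The zeros of C(n,x) are the numbers 2 cos(k pi / n) with k odd, coprime to n and k <= n.
  That these are conjugates of rho(n) follows from w being conjugate to w^k for a root of unity w
  of order dividing 2n and k coprime to 2n; one may take k = p prime, and then a factor g of X^N - 1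
  with g(w) = 0 and g(w^p) nonzero would satisfy both g(w^p) | N and p | g(w^p) in Z[w].
  Conversely, a conjugate z = v + 1/v of rho(n) inherits v^n = -1, so z = 2 cos(k pi / n) with
  k odd, and a common factor d of k and n would give v^(n/d) = -1, a relation that rho(n) violates.

  The sign of 2 cos(k pi / n) is decided by comparing 2k with n, so both counts reduce to counting odd
  k <= L(n) or k <= P(n) coprime to n, by inclusion and exclusion over the odd primes dividing n.
  There are floor((y/d - 1)/2) + 1 odd multiples of an odd d up to y; the terms + 1 cancel in the
  alternating sum over all sets of primes because n has at least one odd prime factor.
*)
theory Submission
  imports Defs
begin

section \<open>Conjugates and integer polynomials\<close>

text \<open>Integer coefficients are used so that reduction modulo a prime makes sense; the values
  \<open>int_eval p w\<close> form the ring \<int>[w].\<close>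

definition int_eval :: "int poly \<Rightarrow> 'a :: comm_ring_1 \<Rightarrow> 'a" where
  "int_eval p x = poly (map_poly of_int p) x"

lemma int_eval_0 [simp]: "int_eval 0 x = 0"
  and int_eval_1 [simp]: "int_eval 1 x = 1"
  and int_eval_pCons [simp]: "int_eval (pCons a p) x = of_int a + x * int_eval p x"
  and int_eval_monom [simp]: "int_eval (monom a n) x = of_int a * x ^ n"
  by (simp_all add: int_eval_def map_poly_pCons map_poly_monom poly_monom)

lemma int_eval_add [simp]: "int_eval (p + q) x = int_eval p x + int_eval q x"
proof -
  have "map_poly of_int (p + q) = map_poly of_int p + (map_poly of_int q :: 'a poly)"
    by (rule poly_eqI) (simp add: coeff_map_poly)
  thus ?thesis by (simp add: int_eval_def)
qed

lemma int_eval_smult [simp]: "int_eval (smult c p) x = of_int c * int_eval p x"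
proof -
  have "map_poly of_int (smult c p) = smult (of_int c) (map_poly of_int p :: 'a poly)"
    by (rule poly_eqI) (simp add: coeff_map_poly)
  thus ?thesis by (simp add: int_eval_def)
qed

lemma int_eval_minus [simp]: "int_eval (- p) x = - int_eval p x"
  using int_eval_smult[of "-1" p x] by simp

lemma int_eval_diff [simp]: "int_eval (p - q) x = int_eval p x - int_eval q x"
  using int_eval_add[of p "- q" x] by simp

lemma int_eval_mult [simp]: "int_eval (p * q) x = int_eval p x * int_eval q x"
  by (induction p) (simp_all add: algebra_simps)

lemma int_eval_power [simp]: "int_eval (p ^ n) x = int_eval p x ^ n"
  by (induction n) simp_all

lemma int_eval_pcompose: "int_eval (pcompose p q) x = int_eval p (int_eval q x)"
  by (induction p) (simp_all add: pcompose_pCons)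

lemma int_eval_of_real: "int_eval p (of_real x :: 'a :: {real_algebra_1, comm_ring_1}) = of_real (int_eval p x)"
  by (induction p) simp_all

text \<open>For algebraic \<open>x\<close> this says that \<open>z\<close> is a conjugate of \<open>x\<close> over the rationals.\<close>

definition int_conj :: "'a :: field_char_0 \<Rightarrow> 'b :: field_char_0 \<Rightarrow> bool" where
  "int_conj x z \<longleftrightarrow> (\<forall>q. int_eval q x = 0 \<longrightarrow> int_eval q z = 0)"

lemma int_conj_trans: "int_conj x y \<Longrightarrow> int_conj y z \<Longrightarrow> int_conj x z"
  by (simp add: int_conj_def)

lemma int_conj_of_real_left [simp]:
  "int_conj (of_real x :: 'a :: {real_algebra_1, field_char_0}) z \<longleftrightarrow> int_conj x z"
  by (simp add: int_conj_def int_eval_of_real)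

text \<open>An annihilating polynomial of least degree is made primitive. Pseudo-division then
  leaves remainder 0, so \<open>g\<close> divides a multiple of \<open>q\<close>, and Gauss's lemma
  for content 1 turns divisibility over the fraction field into divisibility over \<int>.\<close>

lemma int_min_poly_exists:
  fixes x :: "'a :: field_char_0"
  assumes "q0 \<noteq> 0" "int_eval q0 x = 0"
  obtains g where "g \<noteq> 0" "int_eval g x = 0" "\<And>q. int_eval q x = 0 \<Longrightarrow> g dvd q"
proof -
  let ?P = "\<lambda>q. q \<noteq> 0 \<and> int_eval q x = 0"
  obtain d where d: "?P d" and min: "\<And>q. ?P q \<Longrightarrow> degree d \<le> degree q"
    using ex_has_least_nat[of ?P q0 degree] assms by blast
  define g where "g = primitive_part d"
  have "d = smult (content d) g" by (simp add: g_def)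
  hence "of_int (content d) * int_eval g x = 0" using d by (metis int_eval_smult)
  hence g: "g \<noteq> 0" "int_eval g x = 0" "degree g = degree d" "content g = 1"
    using d by (simp_all add: g_def)
  have "g dvd q" if "int_eval q x = 0" for q
  proof -
    obtain a s where a: "a \<noteq> 0" "smult a q = g * s + pseudo_mod q g"
      using pseudo_mod(1)[OF g(1)] by blast
    have "int_eval (smult a q) x = int_eval (g * s + pseudo_mod q g) x" by (simp only: a(2))
    hence "int_eval (pseudo_mod q g) x = 0" using g that by simp
    hence "pseudo_mod q g = 0" using pseudo_mod(2)[OF g(1), of q] min[of "pseudo_mod q g"] g(3)
      by (metis linorder_not_less)
    hence "fract_poly g dvd fract_poly (smult a q)" using a by (intro fract_poly_dvd) simp
    hence "fract_poly g dvd fract_poly q"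
      using a(1) by (simp add: fract_poly_smult dvd_smult_iff)
    thus ?thesis using g(4) by (rule fract_poly_dvdD)
  qed
  with g show ?thesis using that by blast
qed

text \<open>The minimal polynomial \<open>h\<close> of \<open>z\<close> divides that of
  \<open>x\<close>. In \<open>g = h * e\<close> the cofactor cannot vanish at \<open>x\<close>,
  since \<open>g dvd e\<close> would make \<open>h\<close> constant. Algebraicity of
  \<open>x\<close> matters: every \<open>z\<close> satisfies \<open>int_conj x z\<close> when
  \<open>x\<close> is transcendental.\<close>

lemma int_conj_sym:
  fixes x :: "'a :: field_char_0" and z :: "'b :: field_char_0"
  assumes "q0 \<noteq> 0" "int_eval q0 x = 0" "int_conj x z"
  shows "int_conj z x"
proof -
  obtain g where g: "g \<noteq> 0" "int_eval g x = 0" "\<And>q. int_eval q x = 0 \<Longrightarrow> g dvd q"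
    using int_min_poly_exists[OF assms(1,2)] by blast
  have gz: "int_eval g z = 0" using g assms(3) by (simp add: int_conj_def)
  obtain h where h: "h \<noteq> 0" "int_eval h z = 0" "\<And>q. int_eval q z = 0 \<Longrightarrow> h dvd q"
    using int_min_poly_exists[OF g(1) gz] by blast
  obtain e where e: "g = h * e" using h(3)[OF gz] by (elim dvdE)
  have "int_eval h x = 0"
  proof (rule ccontr)
    assume "int_eval h x \<noteq> 0"
    hence "int_eval e x = 0" using g(2) e by simp
    hence "g dvd e" by (rule g(3))
    hence "degree g \<le> degree e" using e g(1) by (intro dvd_imp_degree_le) auto
    hence "degree h = 0" using e g(1) by (auto simp: degree_mult_eq)
    then obtain c where "h = [:c:]" by (rule degree_eq_zeroE)
    thus False using h by simp
  qed
  thus ?thesis using h(3) by (force simp: int_conj_def elim!: dvdE)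
qed

lemma rat_poly_clear_denominators:
  fixes f :: "rat poly"
  obtains c :: int and G where "c > 0" "smult (of_int c) f = map_poly of_int G"
proof -
  have "\<exists>c>0. \<exists>G. smult (of_int c) f = map_poly of_int G"
  proof (induction f)
    case 0
    show ?case by (intro exI[of _ 1] conjI exI[of _ 0]) simp_all
  next
    case (pCons a p)
    then obtain c G where c: "c > 0" "smult (of_int c) p = map_poly of_int G" by blast
    obtain u v where uv: "quotient_of a = (u, v)" by fastforce
    have v: "v > 0" "a = of_int u / of_int v"
      using uv by (auto simp: quotient_of_denom_pos quotient_of_div)
    have "smult (of_int (c * v)) (pCons a p) =
        pCons (of_int (u * c)) (smult (of_int v) (smult (of_int c) p))"
      using v by (simp add: mult_ac)
    also have "\<dots> = map_poly of_int (pCons (u * c) (smult v G))"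
      unfolding c(2) by (simp add: map_poly_pCons map_poly_smult)
    finally show ?case using c v by (intro exI[of _ "c * v"]) auto
  qed
  thus ?thesis using that by blast
qed

lemma map_poly_rat_int: "map_poly of_rat (map_poly of_int p) = (map_poly of_int p :: 'a :: field_char_0 poly)"
  by (simp add: map_poly_map_poly o_def)

text \<open>Clearing denominators in \<open>f\<close> gives an integer polynomial \<open>G\<close>
  of the same degree. Minimality of \<open>f\<close> bounds that degree by the degree of
  \<open>g\<close>, so \<open>G\<close> is a constant times \<open>g\<close>.\<close>

lemma zero_of_rat_min_poly_iff:
  fixes x :: "'a :: field_char_0" and z :: "'b :: field_char_0"
  assumes f: "is_rat_min_poly f x"
  shows "poly (map_poly of_rat f) z = 0 \<longleftrightarrow> int_conj x z"
proof -
  obtain c G where c: "c > 0" "smult (of_int c) f = map_poly of_int G"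
    by (rule rat_poly_clear_denominators)
  \<comment> \<open>The type of \<open>y\<close> is left general because \<open>x\<close> and
    \<open>z\<close> may lie in different fields.\<close>
  have eval: "int_eval G y = of_int c * poly (map_poly of_rat f) y" for y :: "'c :: field_char_0"
    using arg_cong[OF c(2), of "\<lambda>q. poly (map_poly of_rat q) y"]
    by (simp add: map_poly_rat_int int_eval_def poly_of_rat_smult)
  have f0: "f \<noteq> 0" and fx: "poly (map_poly of_rat f) x = 0"
    and min: "\<And>q. q \<noteq> 0 \<Longrightarrow> poly (map_poly of_rat q) x = 0 \<Longrightarrow> degree f \<le> degree q"
    using f by (auto simp: is_rat_min_poly_def)
  have Gx: "int_eval G x = 0" using eval[of x] fx by simp
  have degG: "degree G = degree f"
    using arg_cong[OF c(2), of degree] c(1) by (simp add: degree_map_poly)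
  have G0: "G \<noteq> 0" using c f0 by auto
  show ?thesis
  proof
    assume "int_conj x z"
    with Gx have "int_eval G z = 0" by (simp add: int_conj_def)
    thus "poly (map_poly of_rat f) z = 0" using eval[of z] c by simp
  next
    assume "poly (map_poly of_rat f) z = 0"
    hence Gz: "int_eval G z = 0" using eval[of z] by simp
    obtain g where g: "g \<noteq> 0" "int_eval g x = 0" "\<And>q. int_eval q x = 0 \<Longrightarrow> g dvd q"
      using int_min_poly_exists[OF G0 Gx] by blast
    obtain e where e: "G = g * e" using g(3)[OF Gx] by (elim dvdE)
    have "degree f \<le> degree (map_poly of_int g :: rat poly)"
      using g by (intro min) (auto simp: map_poly_rat_int int_eval_def map_poly_eq_0_iff)
    hence "degree G \<le> degree g" using degG by (simp add: degree_map_poly)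
    hence "degree e = 0" using e G0 by (auto simp: degree_mult_eq)
    then obtain k where "e = [:k:]" by (rule degree_eq_zeroE)
    with e G0 Gz have "int_eval g z = 0" by auto
    thus "int_conj x z" using g(3) by (force simp: int_conj_def elim!: dvdE)
  qed
qed

section \<open>Frobenius congruences modulo a prime\<close>

text \<open>The inner binomial coefficients are divisible by \<open>p\<close>. A general ring is
  taken because the congruence serves both for integers and for integer polynomials.\<close>

lemma dvd_freshmans_dream:
  fixes a b :: "'a :: comm_ring_1"
  assumes "prime p"
  shows "of_nat p dvd (a + b) ^ p - (a ^ p + b ^ p)"
proof -
  have p: "p > 1" using assms by (rule prime_gt_1_nat)
  let ?t = "\<lambda>k. of_nat (p choose k) * a ^ k * b ^ (p - k)"
  have "(a + b) ^ p = sum ?t {..p}" by (rule binomial_ring)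
  also have "{..p} = insert 0 (insert p {0<..<p})" using p by auto
  also have "sum ?t \<dots> = b ^ p + (a ^ p + sum ?t {0<..<p})" using p by (subst sum.insert) auto
  finally have "(a + b) ^ p - (a ^ p + b ^ p) = sum ?t {0<..<p}" by simp
  moreover have "of_nat p dvd sum ?t {0<..<p}"
  proof (intro dvd_sum dvd_mult2)
    fix k assume "k \<in> {0<..<p}"
    hence "p dvd p choose k" using assms p by (intro dvd_choose_prime) auto
    thus "of_nat p dvd (of_nat (p choose k) :: 'a)" by (auto elim!: dvdE)
  qed
  ultimately show ?thesis by simp
qed

lemma int_fermat_dvd:
  assumes "prime p"
  shows "int p dvd a ^ p - a"
proof (induction a rule: int_induct[of _ 0])
  case base
  show ?case using prime_gt_0_nat[OF assms] by (simp add: zero_power)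
next
  case (step1 i)
  have "(i + 1) ^ p - (i + 1) = ((i + 1) ^ p - (i ^ p + 1 ^ p)) + (i ^ p - i)" by simp
  thus ?case using dvd_freshmans_dream[OF assms, of i 1] step1 by (metis dvd_add of_int_of_nat_eq of_int_eq_id id_apply)
next
  case (step2 i)
  have "(i - 1) ^ p - (i - 1) = (i ^ p - i) - ((i - 1 + 1) ^ p - ((i - 1) ^ p + 1 ^ p))" by simp
  thus ?case using dvd_freshmans_dream[OF assms, of "i - 1" 1] step2 by (metis dvd_diff of_int_of_nat_eq of_int_eq_id id_apply)
qed

text \<open>This is g(X^p) = g(X)^p modulo \<open>p\<close>. Writing a polynomial as a + X g, Fermat
  handles the constant, the induction hypothesis handles g, and the freshman's dream splits the
  power of the sum.\<close>

lemma dvd_pcompose_monom_diff_power: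
  fixes g :: "int poly"
  assumes "prime p"
  shows "of_nat p dvd pcompose g (monom 1 p) - g ^ p"
proof (induction g)
  case 0
  show ?case using prime_gt_0_nat[OF assms] by (simp add: zero_power)
next
  case (pCons a g)
  let ?X = "monom 1 1 :: int poly"
  have split: "pCons a g = [:a:] + ?X * g" by (simp add: monom_altdef)
  have "int p dvd a - a ^ p" using int_fermat_dvd[OF assms, of a] by (simp add: dvd_diff_commute)
  hence 1: "of_nat p dvd [:a - a ^ p:]"
    by (auto simp: of_nat_poly elim!: dvdE)
  have 2: "of_nat p dvd monom 1 p * (pcompose g (monom 1 p) - g ^ p)"
    using pCons.IH by (rule dvd_mult)
  have 3: "of_nat p dvd ([:a:] + ?X * g) ^ p - ([:a:] ^ p + (?X * g) ^ p)"
    by (rule dvd_freshmans_dream[OF assms])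
  have Xg: "(?X * g) ^ p = monom 1 p * g ^ p" by (simp add: power_mult_distrib monom_power)
  have "pcompose (pCons a g) (monom 1 p) - pCons a g ^ p =
      ([:a:] - [:a:] ^ p) + (monom 1 p * pcompose g (monom 1 p) - (?X * g) ^ p) -
      (([:a:] + ?X * g) ^ p - ([:a:] ^ p + (?X * g) ^ p))"
    unfolding split[symmetric] by (simp add: pcompose_pCons)
  also have "[:a:] - [:a:] ^ p = [:a - a ^ p:]" by (simp add: poly_const_pow)
  finally have "pcompose (pCons a g) (monom 1 p) - pCons a g ^ p =
      [:a - a ^ p:] + monom 1 p * (pcompose g (monom 1 p) - g ^ p) -
      (([:a:] + ?X * g) ^ p - ([:a:] ^ p + (?X * g) ^ p))" by (simp only: right_diff_distrib Xg)
  thus ?case using 1 2 3 by (simp only: dvd_add dvd_diff)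
qed

section \<open>Conjugates of roots of unity and of \<open>rho n\<close>\<close>

text \<open>X^N - 1 stays squarefree modulo \<open>p\<close>, since \<open>p\<close> does not divide
  \<open>N\<close>. If \<open>g\<close> did not vanish at \<open>w ^ p\<close>, the cofactor
  \<open>h\<close> would, while g(w^p) is g(w)^p = 0 modulo \<open>p\<close>: a double root modulo
  \<open>p\<close>.\<close>

lemma root_of_unity_conj_prime_power:
  fixes w :: "'a :: field_char_0"
  assumes w: "w ^ N = 1" and p: "prime p" "\<not> p dvd N"
  shows "int_conj w (w ^ p)"
proof -
  have N: "N > 0" using p(2) by (cases "N = 0") auto
  define U :: "int poly" where "U = monom 1 N - 1"
  have U: "U \<noteq> 0" "lead_coeff U = 1"
  proof -
    have "degree U = N" unfolding U_def using N
      by (subst diff_conv_add_uminus, subst degree_add_eq_left) (simp_all add: degree_monom_eq)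
    thus "lead_coeff U = 1" using N by (simp add: U_def coeff_eq_0)
    thus "U \<noteq> 0" by auto
  qed
  have eval_U: "int_eval U y = y ^ N - 1" for y :: 'a by (simp add: U_def)
  obtain g where g: "g \<noteq> 0" "int_eval g w = 0" "\<And>q. int_eval q w = 0 \<Longrightarrow> g dvd q"
    using int_min_poly_exists[OF U(1), of w] eval_U w by auto
  obtain h where h: "U = g * h" using g(3)[of U] eval_U w by (auto elim: dvdE)
  have deg_g: "degree g > 0"
  proof (rule ccontr)
    assume "\<not> degree g > 0"
    then obtain c where "g = [:c:]" by (auto elim: degree_eq_zeroE)
    with g show False by simp
  qed
  have "int_eval g (w ^ p) = 0"
  proof (rule ccontr)
    assume nz: "int_eval g (w ^ p) \<noteq> 0"
    have wp: "(w ^ p) ^ N = 1" using w by (metis mult.commute power_mult power_one)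
    hence "int_eval U (w ^ p) = 0" by (simp add: eval_U)
    hence hwp: "int_eval h (w ^ p) = 0" using nz h by simp
    define V where "V = pcompose g (monom 1 p)"
    obtain s where "V - g ^ p = of_nat p * s"
      using dvd_pcompose_monom_diff_power[OF p(1), of g] unfolding V_def by (auto elim: dvdE)
    hence "V = g ^ p + smult (int p) s" by (simp add: of_nat_poly algebra_simps)
    hence "int_eval V w = of_nat p * int_eval s w"
      using g(2) prime_gt_0_nat[OF p(1)] by simp
    hence gwp: "int_eval g (w ^ p) = of_nat p * int_eval s w"
      by (simp add: V_def int_eval_pcompose)
    define q where "q = monom 1 p * s * pcompose (pderiv h) (monom 1 p)"
    text \<open>Differentiating \<open>U = g h\<close> at the common root \<open>w ^ p\<close> of \<open>U\<close> and \<open>h\<close> exhibits \<open>g (w ^ p)\<close>,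
      and hence \<open>p\<close>, as a divisor of \<open>N\<close> in \<open>\<int>[w]\<close>. Reducing modulo \<open>g\<close>, whose leading coefficient
      is a unit, turns this into divisibility in \<open>\<int>\<close>.\<close>
    have "pderiv U = smult (int N) (monom 1 (N - 1))"
      by (simp add: U_def pderiv_diff pderiv_monom smult_monom)
    hence "of_nat N * (w ^ p) ^ (N - 1) = int_eval (pderiv (g * h)) (w ^ p)"
      unfolding h[symmetric] by simp
    also have "\<dots> = int_eval g (w ^ p) * int_eval (pderiv h) (w ^ p)"
      by (simp add: pderiv_mult hwp)
    \<comment> \<open>The extra factor \<open>w ^ p\<close> completes the exponent to
      \<open>N\<close>, so that the power becomes 1.\<close>
    finally have "of_nat N * ((w ^ p) ^ (N - 1) * w ^ p) =
        of_nat p * (w ^ p * int_eval s w * int_eval (pderiv h) (w ^ p))"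
      by (simp add: gwp mult_ac)
    also have "(w ^ p) ^ (N - 1) * w ^ p = 1" using wp N by (metis power_minus_mult)
    finally have N_eq: "of_nat N = of_nat p * int_eval q w"
      by (simp add: q_def int_eval_pcompose)
    obtain a r where ar: "pseudo_divmod q g = (a, r)" by fastforce
    \<comment> \<open>Pseudo-division scales \<open>q\<close> by this factor. It is a unit because
      the leading coefficients of \<open>g\<close> and \<open>h\<close> multiply to that of
      \<open>U\<close>, which is 1.\<close>
    define c where "c = lead_coeff g ^ (Suc (degree q) - degree g)"
    have "lead_coeff g * lead_coeff h = 1" using U(2) unfolding h by (simp add: lead_coeff_mult)
    hence c1: "c dvd 1" unfolding c_def by (metis dvd_triv_left is_unit_power_iff)
    have qr: "smult c q = g * a + r" and r: "r = 0 \<or> degree r < degree g"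
      using pseudo_divmod[OF g(1) ar] by (simp_all add: c_def)
    have "of_int c * int_eval q w = int_eval r w"
      using arg_cong[OF qr, of "\<lambda>f. int_eval f w"] g(2) by simp
    hence "int_eval (smult (int p) r - [:c * int N:]) w = 0"
      using N_eq by (simp add: mult_ac)
    \<comment> \<open>A multiple of \<open>g\<close> of smaller degree must be 0; comparing constant
      coefficients then gives the divisibility in \<int>.\<close>
    hence "g dvd smult (int p) r - [:c * int N:]" by (rule g(3))
    moreover have "degree (smult (int p) r - [:c * int N:]) < degree g"
      using r deg_g by (intro degree_diff_less) auto
    ultimately have "smult (int p) r = [:c * int N:]"
      using dvd_imp_degree_le[of g] by fastforce
    hence "int p * coeff r 0 = c * int N" by (metis coeff_pCons_0 coeff_smult)
    hence "int p dvd c * int N" by (metis dvd_triv_left)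
    hence "int p dvd int N" using c1 by (metis dvd_mult_unit_iff' is_unit_mult_iff)
    with p(2) show False by simp
  qed
  thus ?thesis using g(3) by (force simp: int_conj_def elim!: dvdE)
qed

text \<open>Raising to \<open>k\<close> is done one prime factor at a time: each intermediate power
  is again an \<open>N\<close>-th root of unity, and conjugacy is transitive.\<close>

lemma root_of_unity_conj_power:
  fixes w :: "'a :: field_char_0"
  assumes "w ^ N = 1" "coprime k N" "N > 0"
  shows "int_conj w (w ^ k)"
  using assms(2)
proof (induction k rule: prime_divisors_induct)
  \<comment> \<open>The exponent 0 is coprime to \<open>N\<close> only for \<open>N = 1\<close>, and
    then \<open>w = 1\<close>.\<close>
  case zero
  hence "N = 1" by simp
  thus ?case using assms(1) by (simp add: int_conj_def)
next
  case (unit k)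
  thus ?case by (simp add: int_conj_def)
next
  case (factor p k)
  have "(w ^ k) ^ N = 1" using assms(1) by (metis mult.commute power_mult power_one)
  moreover have "prime p" using factor.hyps by simp
  moreover have "\<not> p dvd N"
    using factor.prems \<open>prime p\<close> by (meson coprime_common_divisor dvd_triv_left not_prime_unit)
  ultimately have "int_conj (w ^ k) ((w ^ k) ^ p)" by (rule root_of_unity_conj_prime_power)
  moreover have "int_conj w (w ^ k)" using factor by simp
  ultimately show ?case using int_conj_trans by (metis mult.commute power_mult)
qed

section \<open>Polynomials in w + 1/w\<close>

text \<open>These are the Dickson polynomials with parameter 1, that is 2 T_m(X/2) for the Chebyshev
  polynomials T_m, built by the recurrence D_(m+2) = X D_(m+1) - D_m.\<close>

lemma dickson_poly_exists:
  obtains D :: "int poly"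
  where "\<And>w :: 'a :: field_char_0. w \<noteq> 0 \<Longrightarrow> int_eval D (w + 1 / w) = w ^ m + 1 / w ^ m"
proof -
  have "\<exists>D. \<forall>w :: 'a. w \<noteq> 0 \<longrightarrow> int_eval D (w + 1 / w) = w ^ m + 1 / w ^ m"
  proof (induction m rule: induct_nat_012)
    case 0
    show ?case by (intro exI[of _ "[:2:]"]) simp
  next
    case 1
    show ?case by (intro exI[of _ "[:0, 1:]"]) simp
  next
    case (ge2 m)
    then obtain D E where
      D: "\<And>w :: 'a. w \<noteq> 0 \<Longrightarrow> int_eval D (w + 1 / w) = w ^ m + 1 / w ^ m" and
      E: "\<And>w :: 'a. w \<noteq> 0 \<Longrightarrow> int_eval E (w + 1 / w) = w ^ Suc m + 1 / w ^ Suc m" by blast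
    have "int_eval ([:0, 1:] * E - D) (w + 1 / w) = w ^ Suc (Suc m) + 1 / w ^ Suc (Suc m)"
      if "w \<noteq> 0" for w :: 'a
      unfolding int_eval_diff int_eval_mult D[OF that] E[OF that] using that
      by (simp add: field_simps)
    thus ?case by blast
  qed
  thus ?thesis using that by blast
qed

text \<open>The value equals (w^m + 1)^2 / w^m, so vanishing of this polynomial at w + 1/w encodes
  the relation w^m = -1. Its value 4 at w = 1 shows that it is not 0.\<close>

lemma dickson_poly_plus_2_exists:
  obtains D :: "int poly"
  where "D \<noteq> 0" "\<And>w :: 'a :: field_char_0. w \<noteq> 0 \<Longrightarrow> int_eval D (w + 1 / w) = w ^ m + 1 / w ^ m + 2"
proof -
  obtain D where D: "\<And>w :: 'a. w \<noteq> 0 \<Longrightarrow> int_eval D (w + 1 / w) = w ^ m + 1 / w ^ m"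
    using dickson_poly_exists[where 'a = 'a] by blast
  hence D2: "int_eval (D + [:2:]) (w + 1 / w) = w ^ m + 1 / w ^ m + 2" if "w \<noteq> 0" for w :: 'a
    using that by simp
  have "D + [:2:] \<noteq> 0" using D2[of 1] by force
  thus ?thesis using that D2 by blast
qed

text \<open>A power of \<open>w\<close> clears the denominators of G(w + 1/w). In a Horner step,
  multiplication by w (w + 1/w) is multiplication by w^2 + 1, the factor
  \<open>[:1, 0, 1:]\<close>.\<close>

lemma reciprocal_poly_exists:
  fixes G :: "int poly"
  obtains H d where "\<And>w :: 'a :: field_char_0. w \<noteq> 0 \<Longrightarrow> int_eval H w = w ^ d * int_eval G (w + 1 / w)"
proof -
  have "\<exists>H d. \<forall>w :: 'a. w \<noteq> 0 \<longrightarrow> int_eval H w = w ^ d * int_eval G (w + 1 / w)"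
  proof (induction G)
    case 0
    show ?case by (intro exI[of _ 0]) simp
  next
    case (pCons a G)
    then obtain H d where H: "\<And>w :: 'a. w \<noteq> 0 \<Longrightarrow> int_eval H w = w ^ d * int_eval G (w + 1 / w)"
      by blast
    have "int_eval (monom a (Suc d) + [:1, 0, 1:] * H) w = w ^ Suc d * int_eval (pCons a G) (w + 1 / w)"
      if "w \<noteq> 0" for w :: 'a
      unfolding int_eval_add int_eval_mult H[OF that] using that
      by (simp add: field_simps)
    thus ?case by blast
  qed
  thus ?thesis using that by blast
qed

lemma int_conj_add_inverse:
  fixes w v :: "'a :: field_char_0"
  assumes "int_conj w v" "w \<noteq> 0" "v \<noteq> 0"
  shows "int_conj (w + 1 / w) (v + 1 / v)"
  unfolding int_conj_def
proof (intro allI impI)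
  fix G assume G: "int_eval G (w + 1 / w) = 0"
  obtain H d where H: "\<And>w :: 'a. w \<noteq> 0 \<Longrightarrow> int_eval H w = w ^ d * int_eval G (w + 1 / w)"
    by (rule reciprocal_poly_exists) blast
  have "int_eval H w = 0" using H[of w] G assms by simp
  hence "int_eval H v = 0" using assms by (simp add: int_conj_def)
  thus "int_eval G (v + 1 / v) = 0" using H[of v] assms by simp
qed

section \<open>The conjugates of rho(n) and the zeros of C(n,x)\<close>

lemma cis_plus_inverse: "cis t + 1 / cis t = complex_of_real (2 * cos t)"
  by (simp add: complex_eq_iff cis_inverse divide_inverse)

text \<open>As a 2n-th root of unity, \<open>w\<close> has an angle pi j / n, and \<open>j\<close>
  is odd since the n-th power is -1. If \<open>j > n\<close>, replacing \<open>j\<close> by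
  \<open>2 * n - j\<close> keeps the parity and the cosine.\<close>

lemma cis_pow_eq_minus_1:
  assumes n: "n > 0" and w: "w ^ n = -1"
  obtains k where "odd k" "k \<le> n" "w + 1 / w = complex_of_real (2 * cos (pi * real k / real n))"
proof -
  have "w ^ (2 * n) = (w ^ n)\<^sup>2" by (simp add: power_mult mult.commute)
  hence "w \<in> {z. z ^ (2 * n) = 1}" using w by simp
  then obtain j where j: "j < 2 * n" "w = cis (2 * pi * real j / real (2 * n))"
    using bij_betw_roots_unity[of "2 * n"] n unfolding bij_betw_def by auto
  have wj: "w = cis (pi * real j / real n)" using j(2) by simp
  have "w ^ n = cis (pi * real j)" unfolding wj Complex.DeMoivre using n by simp
  hence "cos (pi * real j) = -1" using w by (metis cis.simps(1) one_complex.simps(1) uminus_complex.simps(1))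
  hence odd: "odd j" by (auto simp: mult.commute elim!: evenE)
  show ?thesis
  proof (cases "j \<le> n")
    case True
    thus ?thesis using that odd wj cis_plus_inverse by metis
  next
    case False
    have "cos (pi * real (2 * n - j) / real n) = cos (2 * pi - pi * real j / real n)"
      using j n by (intro arg_cong[of _ _ cos]) (simp add: of_nat_diff field_simps)
    also have "\<dots> = cos (pi * real j / real n)" by simp
    finally show ?thesis using that[of "2 * n - j"] odd wj cis_plus_inverse False j(1) by simp
  qed
qed

lemma int_conj_rho_iff:
  assumes n: "n \<ge> 1"
  shows "int_conj (rho n) z \<longleftrightarrow>
    (\<exists>k. odd k \<and> coprime k n \<and> k \<le> n \<and> z = complex_of_real (2 * cos (pi * real k / real n)))"
proof -
  define x where "x = complex_of_real (rho n)"
  define w where "w = cis (pi / real n)"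
  have wn: "w ^ n = -1" using n by (simp add: w_def Complex.DeMoivre)
  have xw: "x = w + 1 / w" by (simp add: x_def w_def rho_def cis_plus_inverse)
  have w0: "w \<noteq> 0" by (simp add: w_def)
  have conj_x: "int_conj (rho n) z \<longleftrightarrow> int_conj x z" by (simp add: x_def)
  show ?thesis unfolding conj_x
  proof
    assume "\<exists>k. odd k \<and> coprime k n \<and> k \<le> n \<and> z = complex_of_real (2 * cos (pi * real k / real n))"
    then obtain k where k: "odd k" "coprime k n" "z = complex_of_real (2 * cos (pi * real k / real n))"
      by blast
    have "w ^ (2 * n) = 1" using wn by (simp add: power_mult mult.commute)
    \<comment> \<open>The relevant exponent is \<open>2 * n\<close>, since
      \<open>w ^ n = -1\<close>; this is where oddness of \<open>k\<close> enters.\<close>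
    moreover have "coprime k (2 * n)" using k by simp
    ultimately have "int_conj w (w ^ k)" using n by (intro root_of_unity_conj_power) auto
    hence "int_conj x (w ^ k + 1 / w ^ k)" unfolding xw using w0 by (intro int_conj_add_inverse) auto
    also have "w ^ k = cis (pi * real k / real n)" by (simp add: w_def Complex.DeMoivre mult.commute)
    finally show "int_conj x z" unfolding k(3) cis_plus_inverse .
  next
    assume xz: "int_conj x z"
    obtain D where D_ne: "D \<noteq> 0"
      and D: "\<And>w :: complex. w \<noteq> 0 \<Longrightarrow> int_eval D (w + 1 / w) = w ^ n + 1 / w ^ n + 2"
      using dickson_poly_plus_2_exists[where 'a = complex] by blast
    have Dx: "int_eval D x = 0" unfolding xw using D[OF w0] wn by simp
    hence Dz: "int_eval D z = 0" using xz unfolding int_conj_def by blast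
    \<comment> \<open>\<open>v\<close> is a root of X^2 - z X + 1, nonzero because the constant term
      is 1.\<close>
    obtain v where v: "v \<noteq> 0" "z = v + 1 / v"
    proof -
      obtain v where "poly [:1, -z, 1:] v = 0"
        using fundamental_theorem_of_algebra[of "[:1, -z, 1:]"] by (auto simp: constant_degree)
      hence v: "v\<^sup>2 + 1 = z * v" by (simp add: algebra_simps power2_eq_square)
      hence "v \<noteq> 0" by auto
      thus ?thesis using that v by (simp add: field_simps power2_eq_square)
    qed
    have "v ^ n + 1 / v ^ n + 2 = 0" using Dz D[OF v(1)] by (simp add: v(2))
    hence "(v ^ n + 1)\<^sup>2 = 0" using v(1) by (simp add: field_simps power2_eq_square)
    hence "v ^ n = -1" by (simp add: add_eq_0_iff2)
    then obtain k where k: "odd k" "k \<le> n" "z = complex_of_real (2 * cos (pi * real k / real n))"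
      using cis_pow_eq_minus_1[of n v] n v(2) by auto
    text \<open>Reducing the fraction \<open>k / n\<close> by \<open>d = gcd k n\<close> shows that \<open>z\<close> already has a relation
      of level \<open>n / d\<close>; it transfers back to \<open>x\<close> and forces \<open>d = 1\<close>.\<close>
    define d where "d = gcd k n"
    have d: "d > 0" "odd d" "d dvd n" "d dvd k" using n k(1) by (auto simp: d_def)
    define m where "m = n div d"
    have m: "n = d * m" "m > 0" using d n by (auto simp: m_def)
    define u where "u = cis (pi * real k / real n)"
    have u: "u \<noteq> 0" "z = u + 1 / u" by (simp_all add: u_def k(3) cis_plus_inverse)
    obtain k' where k': "k = d * k'" using d(4) by (elim dvdE)
    have um: "u ^ m = -1"
    proof -
      have "u ^ m = cis (pi * real k')" using d m unfolding u_def Complex.DeMoivre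
        by (intro arg_cong[of _ _ cis]) (simp add: k' field_simps)
      also have "\<dots> = -1" using k(1) k' by (auto simp: mult.commute complex_eq_iff elim!: oddE simp: algebra_simps)
      finally show ?thesis .
    qed
    obtain E where E: "\<And>w :: complex. w \<noteq> 0 \<Longrightarrow> int_eval E (w + 1 / w) = w ^ m + 1 / w ^ m + 2"
      using dickson_poly_plus_2_exists[where 'a = complex] by blast
    have "int_eval E z = 0" using E[OF u(1)] um by (simp add: u(2))
    moreover have "int_conj z x" using int_conj_sym[OF D_ne Dx xz] .
    ultimately have "int_eval E x = 0" unfolding int_conj_def by blast
    hence eqm: "w ^ m + 1 / w ^ m + 2 = 0" using E[OF w0] by (simp add: xw)
    \<comment> \<open>For \<open>w\<close> itself the relation of level \<open>m\<close> says
      cos(pi/d) = -1, which is impossible for \<open>d > 1\<close>.\<close>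
    have "real m * (pi / real n) = pi / real d" using m d(1) by simp
    hence wm: "w ^ m = cis (pi / real d)" by (simp only: w_def Complex.DeMoivre)
    have "complex_of_real (2 * cos (pi / real d) + 2) = 0"
      using eqm unfolding wm cis_plus_inverse by simp
    hence "2 * cos (pi / real d) + 2 = 0" by (simp only: of_real_eq_0_iff)
    hence "cos (pi / real d) = -1" by linarith
    moreover have "cos (pi / real d) > -1" if "d > 1"
    proof -
      have "pi / real d < pi" using that by (simp add: divide_less_eq)
      hence "cos pi < cos (pi / real d)" by (intro cos_monotone_0_pi) simp_all
      thus ?thesis by simp
    qed
    ultimately have "\<not> d > 1" by linarith
    hence "d = 1" using d(1) by linarith
    hence "coprime k n" by (simp add: d_def coprime_iff_gcd_eq_1)
    with k show "\<exists>k. odd k \<and> coprime k n \<and> k \<le> n \<and> z = complex_of_real (2 * cos (pi * real k / real n))"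
      by blast
  qed
qed

text \<open>Makes the definite description behind \<open>C_poly\<close> proper.\<close>

lemma algebraic_rho:
  assumes "n \<ge> 1"
  shows "algebraic (rho n)"
proof -
  obtain D where D: "D \<noteq> 0"
    "\<And>w :: complex. w \<noteq> 0 \<Longrightarrow> int_eval D (w + 1 / w) = w ^ n + 1 / w ^ n + 2"
    using dickson_poly_plus_2_exists[where 'a = complex] by blast
  define w where "w = cis (pi / real n)"
  have "w ^ n = -1" using assms by (simp add: w_def Complex.DeMoivre)
  hence "int_eval D (complex_of_real (rho n)) = 0"
    using D(2)[of w] by (simp add: w_def rho_def cis_plus_inverse)
  hence "int_eval D (rho n) = 0" by (simp only: int_eval_of_real of_real_eq_0_iff)
  with D(1) show ?thesis
    by (intro algebraicI[of "map_poly of_int D"])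
       (auto simp: int_eval_def coeff_map_poly map_poly_eq_0_iff)
qed

lemma C_zeros_eq:
  assumes "n \<ge> 1"
  shows "C_zeros n =
    (\<lambda>k. complex_of_real (2 * cos (pi * real k / real n))) ` {k. odd k \<and> coprime k n \<and> k \<le> n}"
proof -
  have "\<exists>!p. is_rat_min_poly p (rho n)" using algebraic_rho[OF assms] by (rule ex1_rat_min_poly)
  hence "is_rat_min_poly (C_poly n) (rho n)"
    unfolding C_poly_def rat_min_poly_def by (rule theI')
  hence "z \<in> C_zeros n \<longleftrightarrow> int_conj (rho n) z" for z
    unfolding C_zeros_def mem_Collect_eq by (rule zero_of_rat_min_poly_iff)
  thus ?thesis unfolding int_conj_rho_iff[OF assms] by blast
qed

section \<open>Counting odd numbers coprime to \<open>n\<close>\<close>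

text \<open>Subsets with and without a chosen element \<open>a\<close> pair off with opposite
  signs.\<close>

lemma sum_Pow_minus_one_power_card:
  assumes "finite A"
  shows "(\<Sum>S\<in>Pow A. (-1) ^ card S) = (if A = {} then 1 else 0 :: 'b :: comm_ring_1)"
  using assms
proof (induction A rule: finite_induct)
  case (insert a A)
  have inj: "inj_on (insert a) (Pow A)" using insert.hyps by (auto simp: inj_on_def)
  have "(\<Sum>S\<in>Pow (insert a A). (-1) ^ card S) =
      (\<Sum>S\<in>Pow A. (-1) ^ card S) + (\<Sum>S\<in>Pow A. (-1) ^ card (insert a S) :: 'b)"
    unfolding Pow_insert using insert.hyps inj
    by (subst sum.union_disjoint) (auto simp: sum.reindex)
  also have "(\<Sum>S\<in>Pow A. (-1) ^ card (insert a S) :: 'b) = (\<Sum>S\<in>Pow A. - ((-1) ^ card S))"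
  proof (rule sum.cong)
    fix S assume "S \<in> Pow A"
    hence "finite S" "a \<notin> S" using insert.hyps finite_subset by auto
    thus "(-1) ^ card (insert a S) = - ((-1) ^ card S :: 'b)" by simp
  qed simp
  finally show ?case by (simp add: sum_negf)
qed simp

lemma card_sieve:
  assumes "finite X" "finite A"
  shows "real (card {k \<in> X. \<forall>p\<in>A. \<not> R p k}) =
    (\<Sum>S\<in>Pow A. (-1) ^ card S * real (card {k \<in> X. \<forall>p\<in>S. R p k}))"
proof -
  have "real (card {k \<in> X. \<forall>p\<in>A. \<not> R p k}) = (\<Sum>k\<in>X. if \<forall>p\<in>A. \<not> R p k then 1 else 0)"
    using assms by (simp add: sum.If_cases Int_def)
  also have "\<dots> = (\<Sum>k\<in>X. \<Sum>S\<in>Pow A. if \<forall>p\<in>S. R p k then (-1) ^ card S else 0)"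
  proof (rule sum.cong)
    fix k
    \<comment> \<open>For fixed \<open>k\<close> only subsets of the properties that
      \<open>k\<close> has survive, so the signed sum detects whether there are any.\<close>
    have "(\<Sum>S\<in>Pow A. if \<forall>p\<in>S. R p k then (-1) ^ card S else 0) =
        (\<Sum>S\<in>Pow {p\<in>A. R p k}. (-1) ^ card S :: real)"
      using assms by (intro sum.mono_neutral_cong_right) auto
    also have "\<dots> = (if {p\<in>A. R p k} = {} then 1 else 0)"
      using assms by (intro sum_Pow_minus_one_power_card) simp
    finally show "(if \<forall>p\<in>A. \<not> R p k then 1 else 0) =
        (\<Sum>S\<in>Pow A. if \<forall>p\<in>S. R p k then (-1) ^ card S else 0 :: real)" by auto
  qed simp
  also have "\<dots> = (\<Sum>S\<in>Pow A. \<Sum>k\<in>X. if \<forall>p\<in>S. R p k then (-1) ^ card S else 0)"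
    by (rule sum.swap)
  also have "\<dots> = (\<Sum>S\<in>Pow A. (-1) ^ card S * real (card {k \<in> X. \<forall>p\<in>S. R p k}))"
    using assms by (intro sum.cong) (simp_all add: sum.If_cases Int_def)
  finally show ?thesis .
qed

text \<open>For k = d (2j + 1), the bound k \<le> y reads j \<le> f. As \<open>y\<close> is
  nonnegative, f \<ge> -1, and the value -1 correctly gives the count 0.\<close>

lemma card_odd_multiples:
  assumes "odd d" "y \<ge> 0"
  shows "real (card {k. odd k \<and> d dvd k \<and> real k \<le> y}) = of_int \<lfloor>1 / 2 * (y / real d - 1)\<rfloor> + 1"
proof -
  define f where "f = \<lfloor>1 / 2 * (y / real d - 1)\<rfloor>"
  have d: "d > 0" using assms(1) by (cases d) auto
  have "1 / 2 * (y / real d - 1) \<ge> -1" using assms by simp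
  hence f: "f \<ge> -1" by (simp add: f_def le_floor_iff)
  have le: "real (d * (2 * j + 1)) \<le> y \<longleftrightarrow> j < nat (f + 1)" for j
  proof -
    have "j < nat (f + 1) \<longleftrightarrow> int j \<le> f" by auto
    also have "\<dots> \<longleftrightarrow> real (d * (2 * j + 1)) \<le> y" using d
      by (simp add: f_def le_floor_iff field_simps)
    finally show ?thesis by simp
  qed
  have "{k. odd k \<and> d dvd k \<and> real k \<le> y} = (\<lambda>j. d * (2 * j + 1)) ` {..<nat (f + 1)}"
  proof (intro equalityI subsetI)
    fix k assume "k \<in> {k. odd k \<and> d dvd k \<and> real k \<le> y}"
    hence k: "odd k" "d dvd k" "real k \<le> y" by auto
    then obtain e where e: "k = d * e" by (elim dvdE)
    with k obtain j where "e = 2 * j + 1" by (auto elim: oddE)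
    with e k le[of j] show "k \<in> (\<lambda>j. d * (2 * j + 1)) ` {..<nat (f + 1)}" by auto
  next
    fix k assume "k \<in> (\<lambda>j. d * (2 * j + 1)) ` {..<nat (f + 1)}"
    then obtain j where "k = d * (2 * j + 1)" "j < nat (f + 1)" by auto
    thus "k \<in> {k. odd k \<and> d dvd k \<and> real k \<le> y}" using le[of j] assms(1) by auto
  qed
  moreover have "inj_on (\<lambda>j. d * (2 * j + 1)) {..<nat (f + 1)}" using d by (auto simp: inj_on_def)
  ultimately have "card {k. odd k \<and> d dvd k \<and> real k \<le> y} = nat (f + 1)"
    by (simp add: card_image)
  thus ?thesis using f by (simp add: f_def)
qed

lemma prod_primes_dvd_iff:
  fixes k :: nat
  assumes "finite S" "\<forall>p\<in>S. prime p"
  shows "\<Prod>S dvd k \<longleftrightarrow> (\<forall>p\<in>S. p dvd k)"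
  using assms
proof (induction S rule: finite_induct)
  case (insert a S)
  have "coprime a (\<Prod>S)"
    using insert.hyps insert.prems by (intro prod_coprime_right) (auto intro!: primes_coprime)
  hence "a * \<Prod>S dvd k \<longleftrightarrow> a dvd k \<and> \<Prod>S dvd k"
    by (meson divides_mult dvd_mult_left dvd_mult_right)
  thus ?case using insert by simp
qed simp

text \<open>Brings the sieve into the form of nested sums over \<open>r\<close>; the empty set
  supplies the term outside them.\<close>

lemma sum_Pow_by_card:
  assumes "finite A"
  shows "(\<Sum>S\<in>Pow A. (-1) ^ card S * F S) =
    (F {} + (\<Sum>r = 1..card A. (-1) ^ r * (\<Sum>S\<in>{S. S \<subseteq> A \<and> card S = r}. F S)) :: 'b :: comm_ring_1)"
proof -
  have "(\<Sum>S\<in>Pow A. (-1) ^ card S * F S) =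
      (\<Sum>r = 0..card A. \<Sum>S\<in>{S \<in> Pow A. card S = r}. (-1) ^ card S * F S)"
    using assms by (subst sum.group) (auto intro: card_mono)
  also have "\<dots> = (\<Sum>r = 0..card A. (-1) ^ r * (\<Sum>S\<in>{S. S \<subseteq> A \<and> card S = r}. F S))"
    by (intro sum.cong) (auto simp: sum_distrib_left intro!: sum.cong)
  also have "\<dots> = (\<Sum>S\<in>{S. S \<subseteq> A \<and> card S = 0}. F S) +
      (\<Sum>r = 1..card A. (-1) ^ r * (\<Sum>S\<in>{S. S \<subseteq> A \<and> card S = r}. F S))"
    by (subst sum.atLeast_Suc_atMost) simp_all
  also have "{S. S \<subseteq> A \<and> card S = 0} = {{}}"
    using assms by (auto dest: finite_subset)
  finally show ?thesis by simp
qed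

lemma finite_odd_primes_of: "n \<ge> 1 \<Longrightarrow> finite (odd_primes_of n)"
  unfolding odd_primes_of_def by (rule finite_subset[of _ "{..n}"]) (auto dest: dvd_imp_le)

text \<open>A common prime factor of \<open>k\<close> and \<open>n\<close> is odd because
  \<open>k\<close> is, so the prime 2 needs no test.\<close>

lemma coprime_odd_iff:
  assumes "odd k"
  shows "coprime k n \<longleftrightarrow> (\<forall>p\<in>odd_primes_of n. \<not> p dvd k)"
proof
  assume "coprime k n"
  thus "\<forall>p\<in>odd_primes_of n. \<not> p dvd k"
    by (auto simp: odd_primes_of_def dest: coprime_common_divisor)
next
  assume *: "\<forall>p\<in>odd_primes_of n. \<not> p dvd k"
  show "coprime k n"
  proof (rule ccontr)
    assume "\<not> coprime k n"
    then obtain p where p: "prime p" "p dvd gcd k n"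
      using prime_factor_nat by (metis coprime_iff_gcd_eq_1)
    hence "odd p" using assms by (meson dvd_trans gcd_dvd1)
    thus False using * p by (auto simp: odd_primes_of_def)
  qed
qed

lemma odd_primes_of_nonempty:
  assumes "n \<ge> 1" "\<not> (\<exists>m. n = 2 ^ m)"
  shows "odd_primes_of n \<noteq> {}"
proof -
  obtain b where b: "n = 2 ^ multiplicity 2 n * b" "\<not> 2 dvd b"
    using multiplicity_decompose'[of n 2] assms(1) by auto
  hence "b \<noteq> 1" using assms(2) by (metis mult.right_neutral)
  then obtain p where p: "prime p" "p dvd b" using prime_factor_nat by blast
  hence "p dvd n" using b(1) by (metis dvd_mult)
  moreover have "odd p" using p b(2) by (meson dvd_trans)
  ultimately show ?thesis using p by (auto simp: odd_primes_of_def)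
qed

lemma card_odd_coprime_le:
  assumes n: "n \<ge> 1" "odd_primes_of n \<noteq> {}" and y: "y \<ge> 0"
  shows "real (card {k. odd k \<and> coprime k n \<and> real k \<le> y}) =
    of_int (half_floor y {}) +
    (\<Sum>r = 1..M_num n. (- 1) ^ r * (\<Sum>S\<in>prime_choices n r. real_of_int (half_floor y S)))"
proof -
  let ?A = "odd_primes_of n" and ?X = "{k. odd k \<and> real k \<le> y}"
  have A: "finite ?A" using n(1) by (rule finite_odd_primes_of)
  have X: "finite ?X"
    by (rule finite_subset[of _ "{..nat \<lfloor>y\<rfloor>}"]) (auto simp: le_nat_floor)
  have card: "real (card {k \<in> ?X. \<forall>p\<in>S. p dvd k}) = of_int (half_floor y S) + 1"
    if "S \<in> Pow ?A" for S
  proof -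
    have S: "finite S" "\<forall>p\<in>S. prime p \<and> odd p"
      using that A finite_subset by (auto simp: odd_primes_of_def)
    hence "{k \<in> ?X. \<forall>p\<in>S. p dvd k} = {k. odd k \<and> \<Prod>S dvd k \<and> real k \<le> y}"
      by (auto simp: prod_primes_dvd_iff)
    moreover have "odd (\<Prod>S)"
      using S by (induction S rule: finite_induct) auto
    ultimately show ?thesis using card_odd_multiples[of "\<Prod>S" y] y by (simp add: half_floor_def)
  qed
  have "{k. odd k \<and> coprime k n \<and> real k \<le> y} = {k \<in> ?X. \<forall>p\<in>?A. \<not> p dvd k}"
    using coprime_odd_iff by blast
  hence "real (card {k. odd k \<and> coprime k n \<and> real k \<le> y}) =
      (\<Sum>S\<in>Pow ?A. (-1) ^ card S * real (card {k \<in> ?X. \<forall>p\<in>S. p dvd k}))"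
    using card_sieve[OF X A] by simp
  also have "\<dots> = (\<Sum>S\<in>Pow ?A. (-1) ^ card S * of_int (half_floor y S) + (-1) ^ card S)"
    by (intro sum.cong refl, subst card) (simp_all add: algebra_simps)
  \<comment> \<open>The leftover signs sum to 0 because \<open>?A\<close> is nonempty.\<close>
  also have "\<dots> = (\<Sum>S\<in>Pow ?A. (-1) ^ card S * of_int (half_floor y S))"
    using n(2) by (simp add: sum.distrib sum_Pow_minus_one_power_card[OF A])
  finally show ?thesis
    using sum_Pow_by_card[OF A, of "\<lambda>S. real_of_int (half_floor y S)"]
    by (simp add: M_num_def prime_choices_def)
qed

section \<open>Signs of the zeros and the bounds L and P\<close>

lemma pi_fraction_le_pi: "k \<le> n \<Longrightarrow> pi * real k / real n \<le> pi"
  by (cases "n = 0") (simp_all add: pos_divide_le_eq)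

lemma inj_on_cos_multiples: "inj_on (\<lambda>k. 2 * cos (pi * real k / real n)) {..n}"
proof (rule inj_onI)
  define a where "a = (\<lambda>k. pi * real k / real n)"
  have a: "0 \<le> a k" "k \<in> {..n} \<Longrightarrow> a k \<le> pi" for k
    using pi_fraction_le_pi[of k n] by (simp_all add: a_def)
  fix j k assume *: "j \<in> {..n}" "k \<in> {..n}"
    and "2 * cos (pi * real j / real n) = 2 * cos (pi * real k / real n)"
  hence eq: "cos (a j) = cos (a k)" unfolding a_def by linarith
  have "a j = a k" by (rule cos_inj_pi[OF a(1) a(2)[OF *(1)] a(1) a(2)[OF *(2)] eq])
  thus "j = k" using * by (cases "n = 0") (simp_all add: a_def)
qed

text \<open>Cosine is strictly decreasing on [0, pi] with its zero at pi/2, which corresponds to 2k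
  = n.\<close>

lemma cos_multiple_sign:
  assumes "n \<ge> 1" "k \<le> n"
  shows "cos (pi * real k / real n) > 0 \<longleftrightarrow> 2 * k < n"
    and "cos (pi * real k / real n) < 0 \<longleftrightarrow> n < 2 * k"
proof -
  define r where "r = real k / real n"
  have t: "0 \<le> pi * r" "pi * r \<le> pi"
    using pi_fraction_le_pi[OF assms(2)] by (simp_all add: r_def)
  have "r < 1 / 2 \<longleftrightarrow> real (2 * k) < real n" "r > 1 / 2 \<longleftrightarrow> real n < real (2 * k)"
    using assms(1) by (simp_all add: r_def field_simps)
  hence r: "r < 1 / 2 \<longleftrightarrow> 2 * k < n" "r > 1 / 2 \<longleftrightarrow> n < 2 * k"
    by (simp_all only: of_nat_less_iff)
  have lt: "pi * r < pi / 2 \<longleftrightarrow> r < 1 / 2" "pi / 2 < pi * r \<longleftrightarrow> r > 1 / 2"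
    using mult_less_cancel_left_pos[OF pi_gt_zero, of r "1 / 2"]
      mult_less_cancel_left_pos[OF pi_gt_zero, of "1 / 2" r] by simp_all
  have "cos (pi * r) > 0 \<longleftrightarrow> pi * r < pi / 2" "cos (pi * r) < 0 \<longleftrightarrow> pi / 2 < pi * r"
    using t cos_mono_less_eq[of "pi * r" "pi / 2"] cos_mono_less_eq[of "pi / 2" "pi * r"] by simp_all
  with lt r show "cos (pi * real k / real n) > 0 \<longleftrightarrow> 2 * k < n"
    and "cos (pi * real k / real n) < 0 \<longleftrightarrow> n < 2 * k" by (simp_all add: r_def)
qed

lemma delta_pos_eq:
  assumes n: "n \<ge> 1"
  shows "delta_pos n = card {k. odd k \<and> coprime k n \<and> 2 * k < n}"
proof -
  let ?S = "{k. odd k \<and> coprime k n \<and> 2 * k < n}"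
  have "{x :: real. x > 0 \<and> complex_of_real x \<in> C_zeros n} =
      (\<lambda>k. 2 * cos (pi * real k / real n)) ` ?S"
    unfolding C_zeros_eq[OF n] using cos_multiple_sign(1)[OF n]
    by (auto simp: image_iff simp del: of_real_mult)
  moreover have "inj_on (\<lambda>k. 2 * cos (pi * real k / real n)) ?S"
    by (rule inj_on_subset[OF inj_on_cos_multiples]) auto
  ultimately show ?thesis by (simp add: delta_pos_def card_image)
qed

lemma delta_neg_eq:
  assumes n: "n \<ge> 1"
  shows "delta_neg n = card {k. odd k \<and> coprime k n \<and> n < 2 * k \<and> k \<le> n}"
proof -
  let ?S = "{k. odd k \<and> coprime k n \<and> n < 2 * k \<and> k \<le> n}"
  have "{x :: real. x < 0 \<and> complex_of_real x \<in> C_zeros n} =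
      (\<lambda>k. 2 * cos (pi * real k / real n)) ` ?S"
    unfolding C_zeros_eq[OF n] using cos_multiple_sign(2)[OF n]
    by (auto simp: image_iff simp del: of_real_mult)
  moreover have "inj_on (\<lambda>k. 2 * cos (pi * real k / real n)) ?S"
    by (rule inj_on_subset[OF inj_on_cos_multiples]) auto
  ultimately show ?thesis by (simp add: delta_neg_def card_image)
qed

text \<open>Uniform formulas replace the cases modulo 4. There are (n+2) div 4 odd numbers up to
  n/2, the largest being L, and n div 2 odd numbers below n, the largest being P.\<close>

lemma parameters_eq:
  assumes "n \<ge> 2"
  shows "K_num n = real ((n + 2) div 4) - 1"
    and "L_num n = 2 * real ((n + 2) div 4) - 1"
    and "N_num n = real (n div 2) - real ((n + 2) div 4)"
    and "P_num n = 2 * real (n div 2) - 1"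
proof -
  define t where "t = n div 4"
  consider "n = 4 * t" | "n = 4 * t + 1" | "n = 4 * t + 2" | "n = 4 * t + 3"
    unfolding t_def by linarith
  hence "K_num n = real ((n + 2) div 4) - 1 \<and> N_num n = real (n div 2) - real ((n + 2) div 4) \<and>
      P_num n = 2 * real (n div 2) - 1"
  proof cases
    case 1
    have "\<lfloor>(real n - 2) / 4\<rfloor> = int t - 1" using 1 by (intro floor_unique) simp_all
    moreover have "n div 2 = 2 * t" "(n + 2) div 4 = t" "even n" using 1 by simp_all
    ultimately show ?thesis using 1 by (simp add: K_num_def N_num_def P_num_def diff_divide_distrib)
  next
    case 2
    hence "n mod 4 = 1" "n div 2 = 2 * t" "(n + 2) div 4 = t" by simp_all
    thus ?thesis using 2 by (simp add: K_num_def N_num_def P_num_def)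
  next
    case 3
    have "\<lfloor>(real n - 2) / 4\<rfloor> = int t" using 3 by (intro floor_unique) simp_all
    moreover have "n div 2 = 2 * t + 1" "(n + 2) div 4 = t + 1" "even n" using 3 by simp_all
    ultimately show ?thesis using 3 by (simp add: K_num_def N_num_def P_num_def diff_divide_distrib)
  next
    case 4
    hence "n mod 4 = 3" "n div 2 = 2 * t + 1" "(n + 2) div 4 = t + 1" by simp_all
    thus ?thesis using 4 by (simp add: K_num_def N_num_def P_num_def)
  qed
  thus "K_num n = real ((n + 2) div 4) - 1"
    and "L_num n = 2 * real ((n + 2) div 4) - 1"
    and "N_num n = real (n div 2) - real ((n + 2) div 4)"
    and "P_num n = 2 * real (n div 2) - 1"
    by (simp_all add: L_num_def)
qed

lemma half_floor_empty: "half_floor (2 * real a - 1) {} = int a - 1"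
  unfolding half_floor_def by (rule floor_unique) simp_all

lemma le_double_minus_one: "real k \<le> 2 * real a - 1 \<longleftrightarrow> k < 2 * a"
  by linarith

lemma lt_half_iff_le_L_num:
  assumes "n \<ge> 3" "odd k" "coprime k n"
  shows "2 * k < n \<longleftrightarrow> real k \<le> L_num n"
proof -
  \<comment> \<open>For n = 2 modulo 4 the bound \<open>L_num n\<close> is n/2 itself; this value is
    ruled out by coprimality, as n \<ge> 3.\<close>
  have "2 * k \<noteq> n"
  proof
    assume n: "2 * k = n"
    with assms(3) have "k dvd 1" by (metis coprime_common_divisor dvd_refl dvd_triv_right)
    with n assms(1) show False by simp
  qed
  moreover obtain j where "k = 2 * j + 1" using assms(2) by (elim oddE)
  moreover define t where "t = (n + 2) div 4"
  have "4 * t \<le> n + 2" "n + 2 < 4 * t + 4" unfolding t_def by linarith+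
  ultimately have "2 * k < n \<longleftrightarrow> k < 2 * t" by (cases "j < t") linarith+
  thus ?thesis using assms(1) by (simp add: parameters_eq le_double_minus_one t_def)
qed

lemma le_iff_le_P_num:
  assumes "n \<ge> 2" "odd k" "coprime k n"
  shows "k \<le> n \<longleftrightarrow> real k \<le> P_num n"
proof -
  \<comment> \<open>No \<open>n \<ge> 2\<close> is coprime to itself, so \<open>k\<close> is at most
    the largest odd number below \<open>n\<close>.\<close>
  have "k \<noteq> n" using assms by auto
  moreover obtain j where "k = 2 * j + 1" using assms(2) by (elim oddE)
  moreover define t where "t = n div 2"
  have "2 * t \<le> n" "n < 2 * t + 2" unfolding t_def by linarith+
  ultimately have "k \<le> n \<longleftrightarrow> k < 2 * t" by (cases "j < t") linarith+
  thus ?thesis using assms(1) by (simp add: parameters_eq le_double_minus_one t_def)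
qed

lemma delta_pos_formula:
  assumes n: "n \<ge> 3" "odd_primes_of n \<noteq> {}"
  shows "real (delta_pos n) = K_num n +
    (\<Sum>r = 1..M_num n. (- 1) ^ r * (\<Sum>S\<in>prime_choices n r. real_of_int (half_floor (L_num n) S)))"
proof -
  have n': "n \<ge> 1" "n \<ge> 2" and L: "L_num n \<ge> 0"
    using n(1) parameters_eq(2)[of n] by linarith+
  have "{k. odd k \<and> coprime k n \<and> 2 * k < n} = {k. odd k \<and> coprime k n \<and> real k \<le> L_num n}"
    using lt_half_iff_le_L_num[OF n(1)] by blast
  hence "delta_pos n = card {k. odd k \<and> coprime k n \<and> real k \<le> L_num n}"
    using delta_pos_eq[OF n'(1)] by simp
  moreover have "real_of_int (half_floor (L_num n) {}) = K_num n"
    unfolding parameters_eq[OF n'(2)] half_floor_empty by simp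
  ultimately show ?thesis using card_odd_coprime_le[OF n'(1) n(2) L] by simp
qed

lemma delta_neg_formula:
  assumes n: "n \<ge> 3" "odd_primes_of n \<noteq> {}"
  shows "real (delta_neg n) = N_num n +
    (\<Sum>r = 1..M_num n. (- 1) ^ r *
      (\<Sum>S\<in>prime_choices n r. real_of_int (half_floor (P_num n) S - half_floor (L_num n) S)))"
proof -
  have n': "n \<ge> 1" "n \<ge> 2" and L: "L_num n \<ge> 0" and P: "P_num n \<ge> 0"
    using n(1) parameters_eq(2,4)[of n] by linarith+
  let ?B = "\<lambda>y. {k. odd k \<and> coprime k n \<and> real k \<le> y}"
  have pos: "{k. odd k \<and> coprime k n \<and> 2 * k < n} = ?B (L_num n)"
    using lt_half_iff_le_L_num[OF n(1)] by blast
  have all: "{k. odd k \<and> coprime k n \<and> k \<le> n} = ?B (P_num n)"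
    using le_iff_le_P_num[OF n'(2)] by blast
  \<comment> \<open>No zero vanishes: 2k = n with \<open>k\<close> coprime to \<open>n\<close> would
    force n = 2. Hence the negative zeros are counted by subtracting the positive ones from
    all.\<close>
  have "odd k \<and> coprime k n \<and> k \<le> n \<longleftrightarrow>
      odd k \<and> coprime k n \<and> 2 * k < n \<or> odd k \<and> coprime k n \<and> n < 2 * k \<and> k \<le> n" for k
    using n(1) by (cases "2 * k < n"; cases "n < 2 * k") auto
  hence "{k. odd k \<and> coprime k n \<and> k \<le> n} =
      {k. odd k \<and> coprime k n \<and> 2 * k < n} \<union> {k. odd k \<and> coprime k n \<and> n < 2 * k \<and> k \<le> n}"
    by blast
  also have "card \<dots> = delta_pos n + delta_neg n"
    unfolding delta_pos_eq[OF n'(1)] delta_neg_eq[OF n'(1)]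
    by (rule card_Un_disjoint) (auto intro: finite_subset[of _ "{..n}"])
  finally have "real (delta_neg n) = real (card (?B (P_num n))) - real (delta_pos n)"
    unfolding all by simp
  moreover have "real_of_int (half_floor (P_num n) {}) = N_num n + K_num n"
    unfolding parameters_eq[OF n'(2)] half_floor_empty by simp
  ultimately show ?thesis
    using card_odd_coprime_le[OF n'(1) n(2) P] delta_pos_formula[OF n]
    by (simp add: sum_subtractf algebra_simps)
qed

section \<open>Powers of two and the final assembly\<close>

text \<open>The reflection of \<open>k\<close> to \<open>n - k\<close> preserves oddness, as
  \<open>n\<close> is even, and negates the zero. So the odd numbers 2l + 1 below n/2 give all zeros
  up to sign.\<close>

lemma C_zeros_eq_4_dvd:
  assumes n: "n = 4 * t" "t \<ge> 1" and cop: "\<And>k. odd k \<Longrightarrow> coprime k n"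
  shows "C_zeros n = (\<Union>l\<in>{0..t - 1}.
    {complex_of_real (2 * cos (pi / real n * (2 * real l + 1))),
     complex_of_real (- (2 * cos (pi / real n * (2 * real l + 1))))})" (is "_ = ?R")
proof -
  have C: "C_zeros n = (\<lambda>k. complex_of_real (2 * cos (pi * real k / real n))) ` {k. odd k \<and> k \<le> n}"
    using C_zeros_eq[of n] n cop by (auto simp: Collect_conj_eq)
  have refl: "2 * cos (pi * real (n - k) / real n) = - (2 * cos (pi * real k / real n))"
    if "k \<le> n" for k
  proof -
    have "pi * real (n - k) / real n = pi - pi * real k / real n"
      using that n by (simp add: of_nat_diff field_simps)
    thus ?thesis by simp
  qed
  have idx: "pi / real n * (2 * real l + 1) = pi * real (2 * l + 1) / real n" for l
    by simp
  show ?thesis unfolding C idx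
  proof (intro equalityI subsetI)
    fix z assume "z \<in> (\<lambda>k. complex_of_real (2 * cos (pi * real k / real n))) ` {k. odd k \<and> k \<le> n}"
    then obtain k where k: "odd k" "k \<le> n" "z = complex_of_real (2 * cos (pi * real k / real n))"
      by auto
    show "z \<in> (\<Union>l\<in>{0..t - 1}. {complex_of_real (2 * cos (pi * real (2 * l + 1) / real n)),
        complex_of_real (- (2 * cos (pi * real (2 * l + 1) / real n)))})"
    proof (cases "k < 2 * t")
      case True
      obtain l where "k = 2 * l + 1" using k(1) by (elim oddE)
      with True k show ?thesis by (intro UN_I[of l]) auto
    next
      case False
      have "odd (n - k)" using k n by simp
      then obtain l where l: "n - k = 2 * l + 1" by (elim oddE)
      have "z = complex_of_real (- (2 * cos (pi * real (2 * l + 1) / real n)))"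
        using refl[OF k(2)] k(3) unfolding l by simp
      moreover have "l \<in> {0..t - 1}" using l False n by simp
      ultimately show ?thesis by blast
    qed
  next
    fix z assume "z \<in> (\<Union>l\<in>{0..t - 1}. {complex_of_real (2 * cos (pi * real (2 * l + 1) / real n)),
        complex_of_real (- (2 * cos (pi * real (2 * l + 1) / real n)))})"
    then obtain l where l: "l \<le> t - 1"
      "z = complex_of_real (2 * cos (pi * real (2 * l + 1) / real n)) \<or>
       z = complex_of_real (- (2 * cos (pi * real (2 * l + 1) / real n)))" by auto
    have le: "2 * l + 1 \<le> n" and odd: "odd (2 * l + 1)" "odd (n - (2 * l + 1))"
      using l(1) n by auto
    from l(2) show "z \<in> (\<lambda>k. complex_of_real (2 * cos (pi * real k / real n))) ` {k. odd k \<and> k \<le> n}"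
      unfolding refl[OF le, symmetric] using odd le by (metis (mono_tags, lifting) diff_le_self image_eqI mem_Collect_eq)
  qed
qed

lemma delta_eq_4_dvd:
  assumes n: "n = 4 * t" "t \<ge> 1" and cop: "\<And>k. odd k \<Longrightarrow> coprime k n"
  shows "delta_pos n = t" "delta_neg n = t"
proof -
  have card: "card {k. odd k \<and> k < 2 * a} = a" for a :: nat
  proof -
    have "{k. odd k \<and> k < 2 * a} = (\<lambda>j. 2 * j + 1) ` {..<a}"
      by (auto elim!: oddE)
    moreover have "inj_on (\<lambda>j. 2 * j + 1) {..<a}" by (simp add: inj_on_def)
    ultimately show ?thesis by (simp add: card_image)
  qed
  have "{k. odd k \<and> coprime k n \<and> 2 * k < n} = {k. odd k \<and> k < 2 * t}"
    using n cop by auto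
  thus pos: "delta_pos n = t" using delta_pos_eq[of n] n card by simp
  have "n < 2 * k \<and> k \<le> n \<longleftrightarrow> k < 2 * (2 * t) \<and> \<not> k < 2 * t" if "odd k" for k
  proof -
    have "k \<noteq> 2 * t" "k \<noteq> 2 * (2 * t)" using that by auto
    thus ?thesis using n(1) by linarith
  qed
  hence "{k. odd k \<and> coprime k n \<and> n < 2 * k \<and> k \<le> n} =
      {k. odd k \<and> k < 2 * (2 * t)} - {k. odd k \<and> k < 2 * t}"
    using cop by blast
  moreover have "card \<dots> = 2 * t - t"
    using card[of "2 * t"] card[of t] by (subst card_Diff_subset) auto
  ultimately show "delta_neg n = t" using delta_neg_eq[of n] n by simp
qed

theorem proposition5:
  fixes n :: nat
  assumes "n \<ge> 1"
  shows
    "(\<forall>m\<ge>1. n = 2 ^ m \<longrightarrow>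
        (m = 1 \<longrightarrow> 0 \<in> C_zeros n) \<and>
        (m \<ge> 2 \<longrightarrow>
           real (delta_pos n) = real n / 4 \<and>
           real (delta_neg n) = real n / 4 \<and>
           C_zeros n =
             (\<Union>l\<in>{0..n div 4 - 1}.
                {complex_of_real (2 * cos (pi / real n * (2 * real l + 1))),
                 complex_of_real (- (2 * cos (pi / real n * (2 * real l + 1))))})))
     \<and> (n = 1 \<longrightarrow> C_zeros n = {-2})
     \<and> (n \<ge> 3 \<and> \<not> (\<exists>m. n = 2 ^ m) \<longrightarrow>
          real (delta_pos n) =
            K_num n +
            (\<Sum>r = 1..M_num n. (- 1) ^ r *
               (\<Sum>S\<in>prime_choices n r. real_of_int (half_floor (L_num n) S))))
     \<and> (n \<ge> 3 \<and> \<not> (\<exists>m. n = 2 ^ m) \<longrightarrow>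
          real (delta_neg n) =
            N_num n +
            (\<Sum>r = 1..M_num n. (- 1) ^ r *
               (\<Sum>S\<in>prime_choices n r.
                  real_of_int (half_floor (P_num n) S - half_floor (L_num n) S))))"
proof (intro conjI allI impI)
  fix m :: nat assume "n = 2 ^ m" "m = 1"
  \<comment> \<open>The index k = 1 gives cos(pi/2) = 0.\<close>
  hence "0 = complex_of_real (2 * cos (pi * real 1 / real n))" "coprime 1 n" "(1 :: nat) \<le> n" "odd (1 :: nat)"
    by simp_all
  thus "0 \<in> C_zeros n" unfolding C_zeros_eq[OF assms] by blast
next
  fix m :: nat assume n: "n = 2 ^ m" "m \<ge> 2"
  define t where "t = n div 4"
  have t: "n = 4 * t"
  proof -
    have "(2 :: nat) ^ 2 dvd 2 ^ m" using n(2) by (rule le_imp_power_dvd)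
    thus ?thesis by (simp add: t_def n(1))
  qed
  hence t1: "t \<ge> 1" using assms by simp
  have cop: "coprime k n" if "odd k" for k using that n(1) by simp
  show "real (delta_pos n) = real n / 4" "real (delta_neg n) = real n / 4"
    using delta_eq_4_dvd[OF t t1 cop] t by simp_all
  show "C_zeros n = (\<Union>l\<in>{0..n div 4 - 1}.
      {complex_of_real (2 * cos (pi / real n * (2 * real l + 1))),
       complex_of_real (- (2 * cos (pi / real n * (2 * real l + 1))))})"
    using C_zeros_eq_4_dvd[OF t t1 cop] unfolding t_def .
next
  assume "n = 1"
  hence "{k. odd k \<and> coprime k n \<and> k \<le> n} = {1}" by (auto simp: le_Suc_eq)
  thus "C_zeros n = {-2}" using C_zeros_eq[OF assms] \<open>n = 1\<close> by simp
next
  assume "n \<ge> 3 \<and> \<not> (\<exists>m. n = 2 ^ m)"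
  thus "real (delta_pos n) = K_num n +
      (\<Sum>r = 1..M_num n. (- 1) ^ r * (\<Sum>S\<in>prime_choices n r. real_of_int (half_floor (L_num n) S)))"
    using odd_primes_of_nonempty[OF assms] by (intro delta_pos_formula) auto
next
  assume "n \<ge> 3 \<and> \<not> (\<exists>m. n = 2 ^ m)"
  thus "real (delta_neg n) = N_num n +
      (\<Sum>r = 1..M_num n. (- 1) ^ r *
        (\<Sum>S\<in>prime_choices n r. real_of_int (half_floor (P_num n) S - half_floor (L_num n) S)))"
    using odd_primes_of_nonempty[OF assms] by (intro delta_neg_formula) auto
qed

end
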